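(* Let $(\mathfrak g,g,J)$ be a $2n$-dimensional two-step solvable almost Hermitian Lie algebra with totally real $m$-dimensional commutator ideal $\mathfrak g'$ such that $[\mathfrak g',J\mathfrak g']=\mathfrak g'$. Then $(\mathfrak g,g,J)$ is SKT if and only if there exist an orthonormal basis $(X_1,\dots,X_m)$ of $\mathfrak g'$, $\lambda_1,\dots,\lambda_m\in\mathbb R\setminus\{0\}$ and $\mu_1,\dots,\mu_m\in U_J^*$ with $U_J:=(\mathfrak g'\oplus J\mathfrak g')^\perp$ such that the only non-zero Lie brackets (up to anti-symmetry) are given by $$[JX_i,X_i]=\lambda_iX_i,\quad [Y,X_i]=\mu_i(Y)X_i,\quad [Y,JX_i]=-\mu_i(JY)X_i,\quad [Y,Z]=\sum_{i=1}^m\frac1{\lambda_i}(\mu_i\wedge\mu_i\circ J)(Y,Z)X_i$$ for $i=1,\dots,m$ and $Y,Z\in U_J$. If this is the case, then $\mathfrak g\cong m\,\mathfrak{aff}_{\mathbb R}\oplus\mathbb R^{2n-2m}$.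
   Context: An almost Hermitian Lie algebra $(\mathfrak g,g,J)$ is a finite-dimensional real Lie algebra with an inner product $g$ and an endomorphism $J$, $J^2=-\mathrm{id}$, with $g(J\cdot,J\cdot)=g$; put $\sigma=g(J\cdot,\cdot)$. It is SKT if $J$ is integrable ($[JX,JY]-J[JX,Y]-J[X,JY]-[X,Y]=0$) and $d(J^*d\sigma)=0$, where $d$ is the Chevalley–Eilenberg differential and $(J^*\beta)(X_1,\dots,X_k)=\beta(JX_1,\dots,JX_k)$. $\mathfrak g'=[\mathfrak g,\mathfrak g]$; two-step solvable means $\mathfrak g'$ is Abelian; $\mathfrak g'$ is totally real if $\mathfrak g'\cap J\mathfrak g'=\{0\}$. $[\mathfrak g',J\mathfrak g']$ is the linear span of the brackets. Wedge convention: $(\alpha\wedge\beta)(Y,Z)=\alpha(Y)\beta(Z)-\alpha(Z)\beta(Y)$. $\mathfrak{aff}_{\mathbb R}$ is the two-dimensional non-Abelian Lie algebra and $m\,\mathfrak{aff}_{\mathbb R}$ the direct sum of $m$ copies. *)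

theory Defs
  imports "HOL-Analysis.Analysis" "HOL-Analysis.Finite_Function_Topology"
begin

section \<open>Lie algebras\<close>

definition lie_bracket :: "('a::real_vector \<Rightarrow> 'a \<Rightarrow> 'a) \<Rightarrow> bool" where
  "lie_bracket br \<longleftrightarrow> bilinear br \<and> (\<forall>x. br x x = 0) \<and>
     (\<forall>x y z. br x (br y z) + br y (br z x) + br z (br x y) = 0)"

definition bracket_span :: "('a::real_vector \<Rightarrow> 'a \<Rightarrow> 'a) \<Rightarrow> 'a set \<Rightarrow> 'a set \<Rightarrow> 'a set" where
  "bracket_span br A B = span {br x y | x y. x \<in> A \<and> y \<in> B}"

definition commutator_ideal :: "('a::real_vector \<Rightarrow> 'a \<Rightarrow> 'a) \<Rightarrow> 'a set" where
  "commutator_ideal br = bracket_span br UNIV UNIV"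

definition two_step_solvable :: "('a::real_vector \<Rightarrow> 'a \<Rightarrow> 'a) \<Rightarrow> bool" where
  "two_step_solvable br \<longleftrightarrow>
     (\<forall>x \<in> commutator_ideal br. \<forall>y \<in> commutator_ideal br. br x y = 0)"

text \<open>Isomorphism of Lie algebras carried by subspaces \<open>V\<close>, \<open>W\<close>. Requiring \<open>\<phi>\<close> to be linear on the
  ambient type is no restriction: a linear map on a subspace extends to the whole space.\<close>

definition lie_isomorphic ::
  "'a::real_vector set \<Rightarrow> ('a \<Rightarrow> 'a \<Rightarrow> 'a) \<Rightarrow> 'b::real_vector set \<Rightarrow> ('b \<Rightarrow> 'b \<Rightarrow> 'b) \<Rightarrow> bool" where
  "lie_isomorphic V br W br' \<longleftrightarrow>
     (\<exists>\<phi>. linear \<phi> \<and> bij_betw \<phi> V W \<and> (\<forall>x\<in>V. \<forall>y\<in>V. \<phi> (br x y) = br' (\<phi> x) (\<phi> y)))"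

section \<open>The Lie algebra \<open>m aff\<^sub>\<real> \<oplus> \<real>\<^sup>k\<close>\<close>

text \<open>\<open>aff\<^sub>\<real>\<close> with basis \<open>e\<^sub>1 = (1, 0)\<close>, \<open>e\<^sub>2 = (0, 1)\<close> and \<open>[e\<^sub>1, e\<^sub>2] = e\<^sub>2\<close>.\<close>

definition aff_bracket :: "real \<times> real \<Rightarrow> real \<times> real \<Rightarrow> real \<times> real" where
  "aff_bracket x y = (0, fst x * snd y - snd x * fst y)"

text \<open>As the number of summands is a variable, the sum of \<open>m\<close> copies of a Lie algebra is
  carried by the finitely supported sequences that vanish from index \<open>m\<close> on.\<close>

definition copies :: "nat \<Rightarrow> (nat \<Rightarrow>\<^sub>0 'b::real_vector) set" where
  "copies m = {f. Poly_Mapping.keys f \<subseteq> {..<m}}"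

definition copies_bracket :: "('b::real_vector \<Rightarrow> 'b \<Rightarrow> 'b) \<Rightarrow>
    (nat \<Rightarrow>\<^sub>0 'b) \<Rightarrow> (nat \<Rightarrow>\<^sub>0 'b) \<Rightarrow> (nat \<Rightarrow>\<^sub>0 'b)" where
  "copies_bracket br f g =
     Abs_poly_mapping (\<lambda>i. br (Poly_Mapping.lookup f i) (Poly_Mapping.lookup g i))"

lemma lookup_copies_bracket:
  assumes "br 0 0 = 0"
  shows "Poly_Mapping.lookup (copies_bracket br f g) i =
           br (Poly_Mapping.lookup f i) (Poly_Mapping.lookup g i)"
proof -
  have "{i. br (Poly_Mapping.lookup f i) (Poly_Mapping.lookup g i) \<noteq> 0}
          \<subseteq> Poly_Mapping.keys f \<union> Poly_Mapping.keys g"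
    using assms by (auto simp: in_keys_iff)
  then have "finite {i. br (Poly_Mapping.lookup f i) (Poly_Mapping.lookup g i) \<noteq> 0}"
    by (rule finite_subset) auto
  then show ?thesis
    unfolding copies_bracket_def by (subst Abs_poly_mapping_inverse) auto
qed

definition m_aff_sum_abelian :: "nat \<Rightarrow> nat \<Rightarrow> ((nat \<Rightarrow>\<^sub>0 real \<times> real) \<times> (nat \<Rightarrow>\<^sub>0 real)) set" where
  "m_aff_sum_abelian m k = copies m \<times> copies k"

definition m_aff_sum_abelian_bracket ::
  "(nat \<Rightarrow>\<^sub>0 real \<times> real) \<times> (nat \<Rightarrow>\<^sub>0 real) \<Rightarrow>
   (nat \<Rightarrow>\<^sub>0 real \<times> real) \<times> (nat \<Rightarrow>\<^sub>0 real) \<Rightarrow>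
   (nat \<Rightarrow>\<^sub>0 real \<times> real) \<times> (nat \<Rightarrow>\<^sub>0 real)" where
  "m_aff_sum_abelian_bracket x y = (copies_bracket aff_bracket (fst x) (fst y), 0)"

section \<open>Forms\<close>

text \<open>A \<open>k\<close>-form is a function on lists of vectors; only its values on lists of length \<open>k\<close> matter.
  The Chevalley--Eilenberg differential of a \<open>k\<close>-form is
  \<open>(d\<alpha>)(X\<^sub>0,\<dots>,X\<^sub>k) = \<Sum>\<^bsub>i<j\<^esub> (-1)\<^bsup>i+j\<^esup> \<alpha>([X\<^sub>i,X\<^sub>j],X\<^sub>0,\<dots>,X\<^sub>k)\<close> with \<open>X\<^sub>i\<close> and \<open>X\<^sub>j\<close> omitted from the
  tail on the right.\<close>

definition ce_diff :: "('a \<Rightarrow> 'a \<Rightarrow> 'a) \<Rightarrow> ('a list \<Rightarrow> real) \<Rightarrow> 'a list \<Rightarrow> real" where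
  "ce_diff br \<alpha> Xs =
     (\<Sum>j<length Xs. \<Sum>i<j. (-1) ^ (i + j) * \<alpha> (br (Xs ! i) (Xs ! j) # nths Xs (- {i, j})))"

definition pullback :: "('a \<Rightarrow> 'a) \<Rightarrow> ('a list \<Rightarrow> real) \<Rightarrow> 'a list \<Rightarrow> real" where
  "pullback J \<beta> Xs = \<beta> (map J Xs)"

definition wedge :: "('a \<Rightarrow> real) \<Rightarrow> ('a \<Rightarrow> real) \<Rightarrow> 'a \<Rightarrow> 'a \<Rightarrow> real" where
  "wedge \<alpha> \<beta> Y Z = \<alpha> Y * \<beta> Z - \<alpha> Z * \<beta> Y"

text \<open>Linear functionals on a subspace \<open>U\<close>; values outside \<open>U\<close> are irrelevant.\<close>

definition dual_on :: "'a::real_vector set \<Rightarrow> ('a \<Rightarrow> real) set" where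
  "dual_on U = {\<mu>. (\<forall>x\<in>U. \<forall>y\<in>U. \<mu> (x + y) = \<mu> x + \<mu> y) \<and> (\<forall>c. \<forall>x\<in>U. \<mu> (c *\<^sub>R x) = c * \<mu> x)}"

section \<open>Almost Hermitian Lie algebras\<close>

text \<open>The metric \<open>g\<close> is the inner product of the Euclidean space carrying the Lie algebra.\<close>

definition almost_hermitian_lie_algebra ::
  "('a::euclidean_space \<Rightarrow> 'a \<Rightarrow> 'a) \<Rightarrow> ('a \<Rightarrow> 'a) \<Rightarrow> bool" where
  "almost_hermitian_lie_algebra br J \<longleftrightarrow> lie_bracket br \<and> linear J \<and>
     (\<forall>x. J (J x) = - x) \<and> (\<forall>x y. J x \<bullet> J y = x \<bullet> y)"

definition fundamental_form :: "('a::euclidean_space \<Rightarrow> 'a) \<Rightarrow> 'a list \<Rightarrow> real" where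
  "fundamental_form J Xs = J (Xs ! 0) \<bullet> (Xs ! 1)"

definition integrable_structure :: "('a::real_vector \<Rightarrow> 'a \<Rightarrow> 'a) \<Rightarrow> ('a \<Rightarrow> 'a) \<Rightarrow> bool" where
  "integrable_structure br J \<longleftrightarrow>
     (\<forall>x y. br (J x) (J y) - J (br (J x) y) - J (br x (J y)) - br x y = 0)"

definition skt :: "('a::euclidean_space \<Rightarrow> 'a \<Rightarrow> 'a) \<Rightarrow> ('a \<Rightarrow> 'a) \<Rightarrow> bool" where
  "skt br J \<longleftrightarrow> integrable_structure br J \<and>
     (\<forall>Xs. length Xs = 4 \<longrightarrow>
        ce_diff br (pullback J (ce_diff br (fundamental_form J))) Xs = 0)"

definition totally_real :: "('a::real_vector \<Rightarrow> 'a) \<Rightarrow> 'a set \<Rightarrow> bool" where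
  "totally_real J V \<longleftrightarrow> V \<inter> J ` V = {0}"

text \<open>The space \<open>U\<^sub>J = (\<gg>' \<oplus> J\<gg>')\<^sup>\<bottom>\<close>.\<close>

definition transverse_space :: "('a::euclidean_space \<Rightarrow> 'a \<Rightarrow> 'a) \<Rightarrow> ('a \<Rightarrow> 'a) \<Rightarrow> 'a set" where
  "transverse_space br J =
     orthogonal_comp {x + y | x y. x \<in> commutator_ideal br \<and> y \<in> J ` commutator_ideal br}"

end

theory Submission
  imports Defs
begin

text \<open>Integrability and total reality give \<open>[JX, JY] = [X, Y]\<close> for all \<open>X, Y\<close>, and together with
  two-step solvability they make \<open>X \<star> Y = [JX, Y]\<close> a commutative associative product on \<open>\<gg>'\<close>, whose
  products span \<open>\<gg>'\<close>. The SKT equation on \<open>(X, Y, JZ, JW)\<close> reads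
  \<open>g(X \<star> Z, Y \<star> W) = g(Y \<star> Z, X \<star> W)\<close>, so all multiplications are symmetric. Maximizing the cubic form
  \<open>g(X \<star> X, X)\<close> on the unit sphere splits off one orthogonal idempotent line after the other and yields
  an orthonormal basis with \<open>X\<^sub>i \<star> X\<^sub>j = \<delta>\<^sub>i\<^sub>j \<lambda>\<^sub>i X\<^sub>i\<close>. Since \<open>ad\<close> commutes with the product, each \<open>X\<^sub>i\<close>
  is a common eigenvector, \<open>[x, X\<^sub>i] = \<beta>\<^sub>i(x) X\<^sub>i\<close>, and the whole bracket becomes
  \<open>[x, y] = \<Sum>\<^sub>i \<lambda>\<^sub>i\<^sup>-\<^sup>1 (\<beta>\<^sub>i \<and> \<beta>\<^sub>i \<circ> J)(x, y) X\<^sub>i\<close>. The listed brackets amount to this formula with \<open>\<mu>\<^sub>i\<close> the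
  restriction of \<open>\<beta>\<^sub>i\<close> to \<open>U\<^sub>J\<close>. It makes the SKT equation an identity of exterior forms, and the
  functionals \<open>\<beta>\<^sub>i\<close> and \<open>\<beta>\<^sub>i \<circ> J\<close> are coordinates on the \<open>i\<close>-th copy of \<open>aff\<^sub>\<real>\<close>.\<close>

section \<open>Commutative associative algebras with symmetric multiplications\<close>

locale symmetric_algebra =
  fixes V :: "'a::euclidean_space set" and p :: "'a \<Rightarrow> 'a \<Rightarrow> 'a"
  assumes subspace: "subspace V"
    and bilinear: "bilinear p"
    and closed: "\<And>x y. x \<in> V \<Longrightarrow> y \<in> V \<Longrightarrow> p x y \<in> V"
    and commute: "\<And>x y. x \<in> V \<Longrightarrow> y \<in> V \<Longrightarrow> p x y = p y x"
    and assoc: "\<And>x y z. x \<in> V \<Longrightarrow> y \<in> V \<Longrightarrow> z \<in> V \<Longrightarrow> p (p x y) z = p x (p y z)"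
    and symmetric: "\<And>x y z. x \<in> V \<Longrightarrow> y \<in> V \<Longrightarrow> z \<in> V \<Longrightarrow> p x y \<bullet> z = y \<bullet> p x z"
begin

lemmas p_simps = bilinear_ladd[OF bilinear] bilinear_radd[OF bilinear]
  bilinear_lmul[OF bilinear] bilinear_rmul[OF bilinear]
  bilinear_lzero[OF bilinear] bilinear_rzero[OF bilinear]
  bilinear_lneg[OF bilinear] bilinear_rneg[OF bilinear]
  bilinear_lsub[OF bilinear] bilinear_rsub[OF bilinear]

lemmas in_V = subspace_add[OF subspace] subspace_scale[OF subspace] subspace_diff[OF subspace]
  subspace_neg[OF subspace] closed

text \<open>Symmetry of the multiplications and commutativity make the trilinear form
  \<open>p x y \<bullet> z\<close> totally symmetric; it is the polarization of
  \<open>cube\<close>.\<close>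

lemma rotate: "x \<in> V \<Longrightarrow> y \<in> V \<Longrightarrow> z \<in> V \<Longrightarrow> p x y \<bullet> z = p y z \<bullet> x"
  by (metis symmetric commute inner_commute)

abbreviation cube :: "'a \<Rightarrow> real" where
  "cube x \<equiv> p x x \<bullet> x"

lemma cube_add:
  assumes "x \<in> V" "y \<in> V"
  shows "cube (x + y) = cube x + 3 * (p x x \<bullet> y) + 3 * (p y y \<bullet> x) + cube y"
proof -
  have "p x y \<bullet> x = p x x \<bullet> y" "p x y \<bullet> y = p y y \<bullet> x" "p y x = p x y"
    using assms rotate commute by metis+
  then show ?thesis
    by (simp add: p_simps inner_simps)
qed

lemma cube_scale: "cube (c *\<^sub>R x) = c ^ 3 * cube x"
  by (simp add: p_simps power3_eq_cube)

text \<open>Polarization: \<open>cube (u + v)\<close> and \<open>cube (u - v)\<close> together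
  isolate \<open>p u u \<bullet> v\<close>. Taking \<open>v = p u u\<close> kills all squares, and
  squares determine a commutative product.\<close>

lemma product_zero_if_cube_zero:
  assumes "\<And>x. x \<in> V \<Longrightarrow> cube x = 0" and "x \<in> V" "y \<in> V"
  shows "p x y = 0"
proof -
  have orth: "p u u \<bullet> v = 0" if "u \<in> V" "v \<in> V" for u v
  proof -
    have "cube (u + v) = 0" "cube (u + - v) = 0" "cube u = 0" "cube v = 0"
      using that assms(1) in_V by auto
    then show ?thesis
      using cube_add[of u v] cube_add[of u "- v"] that in_V by (simp add: p_simps)
  qed
  have sq: "p u u = 0" if "u \<in> V" for u
    using orth[OF that closed[OF that that]] by simp
  have "p (x + y) (x + y) = 0" "p x x = 0" "p y y = 0"
    using sq assms in_V by auto
  then have "p x y + p x y = 0"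
    using commute[of x y] assms by (simp add: p_simps)
  then show ?thesis
    by (simp flip: scaleR_2)
qed

text \<open>Compactness of the unit sphere gives \<open>x\<close>; homogeneity of degree three turns
  the maximum into a bound for vectors that are not normalized.\<close>

lemma cube_attains_max:
  assumes "V \<noteq> {0}"
  obtains x where "x \<in> V" "norm x = 1" "\<And>v. v \<in> V \<Longrightarrow> cube v \<le> cube x * norm v ^ 3"
proof -
  let ?S = "V \<inter> sphere 0 1"
  obtain v where "v \<in> V" "v \<noteq> 0"
    using assms subspace subspace_0 by blast
  then have "v /\<^sub>R norm v \<in> ?S"
    using in_V by auto
  moreover have "compact ?S"
    using closed_subspace[OF subspace] by (simp add: closed_Int_compact)
  moreover have "continuous_on ?S cube"
    by (rule continuous_on_inner[OF bilinear_continuous_on_compose[OF _ _ bilinear]])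
      (rule continuous_on_id)+
  ultimately obtain x where x: "x \<in> ?S" "\<And>y. y \<in> ?S \<Longrightarrow> cube y \<le> cube x"
    using continuous_attains_sup[of ?S cube] by blast
  have "cube v \<le> cube x * norm v ^ 3" if "v \<in> V" for v
  proof (cases "v = 0")
    case False
    then have "v /\<^sub>R norm v \<in> ?S"
      using that in_V by auto
    then have "cube (v /\<^sub>R norm v) * norm v ^ 3 \<le> cube x * norm v ^ 3"
      using x(2) by (intro mult_right_mono zero_le_power norm_ge_zero)
    moreover have "cube (v /\<^sub>R norm v) * norm v ^ 3 = cube v"
      using False unfolding cube_scale by (simp add: field_simps)
    ultimately show ?thesis by simp
  qed (simp add: p_simps)
  with x(1) that show thesis by auto
qed

text \<open>First-order condition at the maximum: along the component \<open>y\<close> of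
  \<open>p x x\<close> orthogonal to \<open>x\<close>, the derivative
  \<open>3 * (p x x \<bullet> y) = 3 * (y \<bullet> y)\<close> has to vanish.\<close>

lemma max_is_eigenvector:
  assumes x: "x \<in> V" "norm x = 1" and max: "\<And>v. v \<in> V \<Longrightarrow> cube v \<le> cube x * norm v ^ 3"
  shows "p x x = cube x *\<^sub>R x"
proof -
  have xx: "x \<bullet> x = 1"
    using x by (simp add: dot_square_norm)
  \<comment> \<open>\<open>cube\<close> is odd, so its maximum is nonnegative; \<open>bound\<close>
    multiplies an inequality by it.\<close>
  have "cube (- x) \<le> cube x * norm x ^ 3"
    using max[of "- x"] x in_V by simp
  then have pos: "0 \<le> cube x"
    using x by (simp add: p_simps)
  define y where "y = p x x - cube x *\<^sub>R x"
  have y: "y \<in> V"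
    unfolding y_def using x in_V by simp
  have xy: "x \<bullet> y = 0"
    unfolding y_def using xx by (simp add: inner_diff_right inner_commute)
  \<comment> \<open>The third power of the norm is replaced by the fourth, which is no smaller as
    the norm is at least \<open>1\<close>, and is polynomial in \<open>t\<close> without linear
    term. Both sides agree at \<open>t = 0\<close>, so \<open>h\<close> below has a maximum
    there.\<close>
  have bound: "cube x + 3 * t * (p x x \<bullet> y) + 3 * t\<^sup>2 * (p y y \<bullet> x) + t ^ 3 * cube y
      \<le> cube x * (1 + t\<^sup>2 * (y \<bullet> y))\<^sup>2" for t
  proof -
    have "(norm (x + t *\<^sub>R y))\<^sup>2 = 1 + t\<^sup>2 * (y \<bullet> y)"
      unfolding power2_norm_eq_inner using xx xy
      by (simp add: inner_simps inner_commute power2_eq_square)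
    moreover have "1 \<le> norm (x + t *\<^sub>R y)"
      using calculation by (metis inner_ge_zero le_add_same_cancel1 norm_ge_zero one_le_power
          power2_le_imp_le power_one zero_le_mult_iff zero_le_power2)
    then have "norm (x + t *\<^sub>R y) ^ 3 \<le> norm (x + t *\<^sub>R y) ^ 4"
      by (intro power_increasing) auto
    ultimately have "norm (x + t *\<^sub>R y) ^ 3 \<le> (1 + t\<^sup>2 * (y \<bullet> y))\<^sup>2"
      by (metis mult_2 numeral_Bit0 power_mult)
    then have "cube (x + t *\<^sub>R y) \<le> cube x * (1 + t\<^sup>2 * (y \<bullet> y))\<^sup>2"
      using max[of "x + t *\<^sub>R y"] pos x y in_V by (meson mult_left_mono order_trans)
    moreover have "cube (x + t *\<^sub>R y)
        = cube x + 3 * t * (p x x \<bullet> y) + 3 * t\<^sup>2 * (p y y \<bullet> x) + t ^ 3 * cube y"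
      using cube_add[of x "t *\<^sub>R y"] x y in_V
      by (simp add: p_simps cube_scale power2_eq_square power3_eq_cube)
    ultimately show ?thesis by simp
  qed
  define h where "h t = cube x + 3 * t * (p x x \<bullet> y) + 3 * t\<^sup>2 * (p y y \<bullet> x) + t ^ 3 * cube y
      - cube x * (1 + t\<^sup>2 * (y \<bullet> y))\<^sup>2" for t :: real
  have "(h has_real_derivative 3 * (p x x \<bullet> y)) (at 0)"
    unfolding h_def by (auto intro!: derivative_eq_intros)
  then have "3 * (p x x \<bullet> y) = 0"
    using bound by (intro DERIV_local_max[where f = h and x = 0 and d = 1]) (auto simp: h_def)
  then have "y \<bullet> y = 0"
    using xy by (simp add: y_def inner_diff_left inner_commute)
  then show ?thesis
    by (simp add: y_def)
qed

text \<open>If \<open>p x\<close> did not vanish on \<open>x\<^sup>\<bottom>\<close>, then, since \<open>x\<close> is idempotent up to scaling, it would have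
  a unit eigenvector \<open>z \<bottom> x\<close> with the same eigenvalue as \<open>x\<close>, and one of \<open>x \<plusminus> z\<close> would violate
  maximality.\<close>

lemma max_annihilates_orthogonal:
  assumes x: "x \<in> V" "norm x = 1" and max: "\<And>v. v \<in> V \<Longrightarrow> cube v \<le> cube x * norm v ^ 3"
    and pos: "0 < cube x" and y: "y \<in> V" "x \<bullet> y = 0"
  shows "p x y = 0"
proof (rule ccontr)
  assume nz: "p x y \<noteq> 0"
  have eig: "p x x = cube x *\<^sub>R x"
    by (rule max_is_eigenvector[OF x max])
  define w where "w = p x y"
  have w: "w \<in> V"
    unfolding w_def using x y in_V by simp
  have pxw: "p x w = cube x *\<^sub>R w"
  proof -
    have "p (p x x) y = cube x *\<^sub>R p x y"
      by (subst eig) (simp add: p_simps)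
    then show ?thesis
      unfolding w_def using assoc[of x x y] x y by simp
  qed
  have xw: "x \<bullet> w = 0"
  proof -
    have "x \<bullet> w = p x x \<bullet> y"
      unfolding w_def using symmetric[of x x y] x y by simp
    then show ?thesis
      by (subst (asm) eig) (simp add: y)
  qed
  \<comment> \<open>The factor \<open>c\<close> normalizes \<open>w\<close>, with the sign that
    makes \<open>cube z\<close> nonnegative.\<close>
  define c where "c = (if cube w \<ge> 0 then 1 else - 1) / norm w"
  define z where "z = c *\<^sub>R w"
  have z: "z \<in> V" "x \<bullet> z = 0" "p x z = cube x *\<^sub>R z"
    unfolding z_def using w xw pxw in_V by (auto simp: p_simps)
  have nz1: "norm z = 1"
    using nz by (simp add: z_def c_def w_def[symmetric])
  have "0 \<le> cube z"
    unfolding z_def cube_scale c_def by (simp add: power_divide divide_simps)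
  moreover have "p z z \<bullet> x = cube x"
    using rotate[of x z z] x z nz1 by (simp add: dot_square_norm)
  moreover have "p x x \<bullet> z = 0"
    using z by (subst eig) simp
  \<comment> \<open>The mixed term \<open>p z z \<bullet> x\<close> contributes
    \<open>3 * cube x\<close>. Since \<open>x + z\<close> has norm \<open>sqrt 2\<close>, maximality
    allows at most \<open>2 * sqrt 2 * cube x\<close>.\<close>
  ultimately have "4 * cube x \<le> cube (x + z)"
    using cube_add[of x z] x z by simp
  also have "\<dots> \<le> cube x * norm (x + z) ^ 3"
    using max x z in_V by simp
  finally have "4 \<le> norm (x + z) ^ 3"
    using pos by (simp add: mult.commute)
  moreover have "(norm (x + z))\<^sup>2 = 2"
    using norm_add_Pythagorean[of x z] x nz1 z by (simp add: orthogonal_def)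
  ultimately have "4 \<le> norm (x + z) * 2"
    by (simp add: power3_eq_cube power2_eq_square)
  then have "2\<^sup>2 \<le> (norm (x + z))\<^sup>2"
    by (intro power_mono) auto
  with \<open>(norm (x + z))\<^sup>2 = 2\<close> show False by simp
qed

text \<open>If the maximum of \<open>cube\<close> is positive, its maximizer annihilates all
  orthogonal vectors; otherwise \<open>cube\<close>, being odd, vanishes on \<open>V\<close>, and
  the product with it.\<close>

lemma exists_splitting_vector:
  assumes "V \<noteq> {0}"
  obtains x where "x \<in> V" "norm x = 1" "p x x = cube x *\<^sub>R x"
    "\<And>y. y \<in> V \<Longrightarrow> x \<bullet> y = 0 \<Longrightarrow> p x y = 0"
proof -
  obtain x where x: "x \<in> V" "norm x = 1" "\<And>v. v \<in> V \<Longrightarrow> cube v \<le> cube x * norm v ^ 3"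
    using cube_attains_max[OF assms] by metis
  have "p x y = 0" if "y \<in> V" "x \<bullet> y = 0" for y
  proof (cases "0 < cube x")
    case True
    then show ?thesis using max_annihilates_orthogonal x that by blast
  next
    case False
    have le: "cube v \<le> 0" if "v \<in> V" for v
      using x(3)[OF that] False by (meson mult_nonpos_nonneg norm_ge_zero not_less order_trans zero_le_power)
    have "cube v = 0" if "v \<in> V" for v
      using le[OF that] le[of "- v"] that in_V by (simp add: p_simps)
    then show ?thesis using product_zero_if_cube_zero x that by blast
  qed
  then show thesis using that x max_is_eigenvector[OF x] by blast
qed

end

text \<open>Induction on the dimension, splitting off \<open>x\<close>. Its complement
  \<open>W\<close> is closed under \<open>p\<close>, since
  \<open>x \<bullet> p y z = p y x \<bullet> z = 0\<close> for \<open>y\<close>, \<open>z\<close> in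
  \<open>W\<close>. Some \<open>lam i\<close> may vanish here; for the Lie algebra this is excluded
  later, because products span \<open>\<g>\<close>.\<close>

lemma symmetric_algebra_diagonalizable:
  assumes "symmetric_algebra V p" "dim V = d"
  shows "\<exists>X lam. (\<forall>i\<in>{1..d}. \<forall>j\<in>{1..d}. X i \<bullet> X j = (if i = j then 1 else 0)) \<and>
    span (X ` {1..d}) = V \<and>
    (\<forall>i\<in>{1..d}. \<forall>j\<in>{1..d}. p (X i) (X j) = (if i = j then lam i *\<^sub>R X i else 0))"
  using assms
proof (induction d arbitrary: V)
  case 0
  then interpret symmetric_algebra V p by simp
  have "V = {0}"
    using 0 subspace_0[OF subspace] by auto
  then show ?case by simp
next
  case (Suc d)
  then interpret symmetric_algebra V p by simp
  have "V \<noteq> {0}"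
    using Suc.prems by (metis dim_eq_0 nat.distinct(1) subset_refl)
  then obtain x where x: "x \<in> V" "norm x = 1" "p x x = cube x *\<^sub>R x"
    "\<And>y. y \<in> V \<Longrightarrow> x \<bullet> y = 0 \<Longrightarrow> p x y = 0"
    using exists_splitting_vector by blast
  have xx: "x \<bullet> x = 1"
    using x by (simp add: dot_square_norm)
  define W where "W = {y \<in> V. x \<bullet> y = 0}"
  have "symmetric_algebra W p"
  proof
    show "Real_Vector_Spaces.subspace W"
      unfolding W_def using subspace by (auto simp: subspace_def inner_simps)
    show "p y z \<in> W" if "y \<in> W" "z \<in> W" for y z
    proof -
      have "x \<bullet> p y z = 0"
        using that x symmetric[of y x z] commute[of x y] by (auto simp: W_def)
      then show ?thesis using that closed by (auto simp: W_def)
    qed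
  qed (auto simp: W_def commute assoc symmetric bilinear)
  then interpret W: symmetric_algebra W p .
  have span: "span (insert x W) = V"
  proof
    show "span (insert x W) \<subseteq> V"
      by (rule span_minimal) (use x subspace in \<open>auto simp: W_def\<close>)
    show "V \<subseteq> span (insert x W)"
    proof
      fix y assume "y \<in> V"
      then have "y - (x \<bullet> y) *\<^sub>R x \<in> W"
        using x xx in_V by (auto simp: W_def inner_simps)
      then have "(y - (x \<bullet> y) *\<^sub>R x) + (x \<bullet> y) *\<^sub>R x \<in> span (insert x W)"
        by (intro span_add span_scale) (auto intro: span_base)
      then show "y \<in> span (insert x W)" by simp
    qed
  qed
  have "x \<notin> span W"
    using W.subspace xx by (simp add: span_eq_iff[THEN iffD2] W_def)
  then have "dim W = d"
    using dim_insert[of x W] span Suc.prems by (metis Suc_eq_plus1 add_right_cancel dim_span)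
  with Suc.IH[OF W.symmetric_algebra_axioms] obtain X lam where
    X: "\<And>i j. i \<in> {1..d} \<Longrightarrow> j \<in> {1..d} \<Longrightarrow> X i \<bullet> X j = (if i = j then 1 else 0)"
    "span (X ` {1..d}) = W"
    "\<And>i j. i \<in> {1..d} \<Longrightarrow> j \<in> {1..d} \<Longrightarrow> p (X i) (X j) = (if i = j then lam i *\<^sub>R X i else 0)"
    by blast
  have XW: "X i \<in> V" "x \<bullet> X i = 0" "X i \<bullet> x = 0" "p x (X i) = 0" "p (X i) x = 0"
    if "i \<in> {1..d}" for i
  proof -
    have "X i \<in> W"
      using X(2) that by (metis imageI span_base)
    then show "X i \<in> V" "x \<bullet> X i = 0" "X i \<bullet> x = 0" "p x (X i) = 0" "p (X i) x = 0"
      using x commute[of x "X i"] by (auto simp: W_def inner_commute)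
  qed
  let ?X = "X(Suc d := x)" and ?lam = "lam(Suc d := cube x)"
  have set: "{1..Suc d} = insert (Suc d) {1..d}"
    by auto
  have img: "?X ` {1..Suc d} = insert x (X ` {1..d})"
    unfolding set by auto
  have "span (insert x (X ` {1..d})) = V"
    using X(2) span by (simp add: span_insert span_eq_iff[THEN iffD2, OF W.subspace])
  then have "span (?X ` {1..Suc d}) = V"
    by (simp only: img)
  moreover have "?X i \<bullet> ?X j = (if i = j then 1 else 0)
      \<and> p (?X i) (?X j) = (if i = j then ?lam i *\<^sub>R ?X i else 0)"
    if "i \<in> {1..Suc d}" "j \<in> {1..Suc d}" for i j
  proof (cases "i = Suc d"; cases "j = Suc d")
    assume "i = Suc d" "j = Suc d"
    then show ?thesis using x(3) xx by auto
  next
    assume "i = Suc d" "j \<noteq> Suc d"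
    then show ?thesis using XW[of j] that by auto
  next
    assume "i \<noteq> Suc d" "j = Suc d"
    then show ?thesis using XW[of i] that by auto
  next
    assume "i \<noteq> Suc d" "j \<noteq> Suc d"
    then show ?thesis using X that by auto
  qed
  ultimately show ?case by (intro exI[of _ ?X] exI[of _ ?lam]) auto
qed

section \<open>Orthonormal families and finite sequences\<close>

lemma orthonormal_expansion:
  fixes X :: "'i \<Rightarrow> 'a::real_inner"
  assumes "finite I" and "\<And>i j. i \<in> I \<Longrightarrow> j \<in> I \<Longrightarrow> X i \<bullet> X j = (if i = j then 1 else 0)"
    and v: "v \<in> span (X ` I)"
  shows "v = (\<Sum>i\<in>I. (X i \<bullet> v) *\<^sub>R X i)"
proof (rule linear_eq_on_span[OF _ _ _ v, where f = "\<lambda>v. v"])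
  show "linear (\<lambda>v. \<Sum>i\<in>I. (X i \<bullet> v) *\<^sub>R X i)"
    by (rule linearI)
      (simp_all add: inner_simps scaleR_add_left sum.distrib scaleR_sum_right)
  fix x assume "x \<in> X ` I"
  then obtain j where j: "j \<in> I" "x = X j" by auto
  have "(\<Sum>i\<in>I. (X i \<bullet> x) *\<^sub>R X i) = (\<Sum>i\<in>I. if i = j then X i else 0)"
    using j assms(2) by (intro sum.cong refl) simp
  then show "x = (\<Sum>i\<in>I. (X i \<bullet> x) *\<^sub>R X i)"
    using j assms(1) by simp
qed (rule linear_ident)

lemma inner_orthonormal_sum:
  fixes X :: "'i \<Rightarrow> 'a::real_inner"
  assumes "finite I" and "\<And>i j. i \<in> I \<Longrightarrow> j \<in> I \<Longrightarrow> X i \<bullet> X j = (if i = j then 1 else 0)"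
    and "j \<in> I"
  shows "X j \<bullet> (\<Sum>i\<in>I. c i *\<^sub>R X i) = c j"
proof -
  have "X j \<bullet> (\<Sum>i\<in>I. c i *\<^sub>R X i) = (\<Sum>i\<in>I. if j = i then c i else 0)"
    unfolding inner_sum_right using assms(2,3) by (intro sum.cong refl) simp
  then show ?thesis
    using assms by simp
qed

lemma orthonormal_basis_indexed:
  fixes S :: "'a::euclidean_space set"
  assumes "subspace S"
  obtains e :: "nat \<Rightarrow> 'a" where
    "\<And>i j. i < dim S \<Longrightarrow> j < dim S \<Longrightarrow> e i \<bullet> e j = (if i = j then 1 else 0)"
    "span (e ` {..<dim S}) = S"
proof -
  obtain B where B: "pairwise orthogonal B" "\<And>x. x \<in> B \<Longrightarrow> norm x = 1" "independent B"
      "card B = dim S" "span B = S"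
    using orthonormal_basis_subspace[OF assms] by metis
  obtain e where e: "bij_betw e {0..<card B} B"
    using ex_bij_betw_nat_finite B(3) independent_imp_finite by blast
  have "e i \<bullet> e j = (if i = j then 1 else 0)" if "i < dim S" "j < dim S" for i j
  proof -
    have "e i \<in> B" "e j \<in> B" "e i = e j \<longleftrightarrow> i = j"
      using e that B(4) by (auto simp: bij_betw_def inj_on_def)
    then show ?thesis
      using B(1,2) by (auto simp: pairwise_def orthogonal_def dot_square_norm)
  qed
  moreover have "e ` {..<dim S} = B"
    using e B(4) by (simp add: bij_betw_def lessThan_atLeast0)
  ultimately show thesis
    using that B(5) by metis
qed

text \<open>Cutting off at \<open>k\<close> keeps the support finite for every \<open>f\<close>, as
  \<open>Abs_poly_mapping\<close> demands.\<close>

definition finite_seq :: "nat \<Rightarrow> (nat \<Rightarrow> 'b::zero) \<Rightarrow> nat \<Rightarrow>\<^sub>0 'b" where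
  "finite_seq k f = Abs_poly_mapping (\<lambda>i. if i < k then f i else 0)"

lemma lookup_finite_seq [simp]:
  "Poly_Mapping.lookup (finite_seq k f) i = (if i < k then f i else 0)"
proof -
  have "finite {i. (if i < k then f i else 0) \<noteq> 0}"
    by (rule finite_subset[of _ "{..<k}"]) auto
  then show ?thesis
    by (simp add: finite_seq_def)
qed

lemma lookup_scaleR: "Poly_Mapping.lookup (r *\<^sub>R f) i = r *\<^sub>R Poly_Mapping.lookup f i"
proof -
  have "finite {i. r *\<^sub>R Poly_Mapping.lookup f i \<noteq> 0}"
    by (rule finite_subset[OF _ finite_lookup[of f]]) auto
  then show ?thesis
    by (simp add: scaleR_poly_mapping_def)
qed

section \<open>Almost Hermitian Lie algebras\<close>

lemma ce_diff_fundamental_form: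
  "ce_diff br (fundamental_form J) [x, y, z] =
     - (J (br x y) \<bullet> z) + J (br x z) \<bullet> y - J (br y z) \<bullet> x"
  by (simp add: ce_diff_def fundamental_form_def nths_Cons lessThan_Suc)

lemma ce_diff_3form:
  "ce_diff br \<alpha> [a, b, c, d] =
     - \<alpha> [br a b, c, d] + \<alpha> [br a c, b, d] - \<alpha> [br b c, a, d]
     - \<alpha> [br a d, b, c] + \<alpha> [br b d, a, c] - \<alpha> [br c d, a, b]"
  by (simp add: ce_diff_def nths_Cons lessThan_Suc)

text \<open>For a \<open>J\<close>-invariant bracket this is minus the pullback of
  \<open>d\<sigma>\<close> by \<open>J\<close>, up to sign the torsion 3-form of the Bismut
  connection.\<close>

definition torsion :: "('a::euclidean_space \<Rightarrow> 'a \<Rightarrow> 'a) \<Rightarrow> 'a \<Rightarrow> 'a \<Rightarrow> 'a \<Rightarrow> real" where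
  "torsion br x y z = br x y \<bullet> z + br y z \<bullet> x + br z x \<bullet> y"

text \<open>Minus the Chevalley-Eilenberg differential of \<open>torsion\<close>, written out on
  four vectors.\<close>

definition torsion_diff :: "('a::euclidean_space \<Rightarrow> 'a \<Rightarrow> 'a) \<Rightarrow> 'a \<Rightarrow> 'a \<Rightarrow> 'a \<Rightarrow> 'a \<Rightarrow> real" where
  "torsion_diff br a b c d =
     torsion br (br a b) c d - torsion br (br a c) b d + torsion br (br a d) b c
     + torsion br (br b c) a d - torsion br (br b d) a c + torsion br (br c d) a b"

locale hermitian_lie_algebra =
  fixes br :: "'a::euclidean_space \<Rightarrow> 'a \<Rightarrow> 'a" and J :: "'a \<Rightarrow> 'a"
  assumes almost_hermitian: "almost_hermitian_lie_algebra br J"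
begin

lemma bilinear_br: "bilinear br"
  and br_self: "br x x = 0"
  and jacobi: "br x (br y z) + br y (br z x) + br z (br x y) = 0"
  and linear_J: "linear J"
  and J_J [simp]: "J (J x) = - x"
  and J_isometry [simp]: "J x \<bullet> J y = x \<bullet> y"
  using almost_hermitian
  unfolding almost_hermitian_lie_algebra_def lie_bracket_def by auto

lemmas br_simps = bilinear_ladd[OF bilinear_br] bilinear_radd[OF bilinear_br]
  bilinear_lmul[OF bilinear_br] bilinear_rmul[OF bilinear_br]
  bilinear_lzero[OF bilinear_br] bilinear_rzero[OF bilinear_br]
  bilinear_lneg[OF bilinear_br] bilinear_rneg[OF bilinear_br]
  bilinear_lsub[OF bilinear_br] bilinear_rsub[OF bilinear_br]

lemmas J_simps = linear_add[OF linear_J] linear_scale[OF linear_J] linear_0[OF linear_J]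
  linear_neg[OF linear_J] linear_diff[OF linear_J] linear_sum[OF linear_J]

lemma linear_left: "linear (\<lambda>x. br x y)"
  using bilinear_br by (simp add: bilinear_def)

lemma br_skew: "br x y = - br y x"
proof -
  have "br (x + y) (x + y) = br x x + br y x + (br x y + br y y)"
    by (simp only: br_simps(1,2))
  then have "br y x + br x y = 0"
    by (simp add: br_self)
  then show ?thesis
    by (metis add.commute eq_neg_iff_add_eq_0)
qed

lemma br_derivation: "br x (br y z) = br (br x y) z + br y (br x z)"
proof -
  have "br x (br y z) = - br y (br z x) - br z (br x y)"
    using jacobi[of x y z] by (simp add: algebra_simps eq_neg_iff_add_eq_0)
  then show ?thesis
    by (metis add.commute br_skew br_simps(8) diff_conv_add_uminus)
qed

lemma J_eq_0_iff [simp]: "J x = 0 \<longleftrightarrow> x = 0"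
proof
  assume "J x = 0"
  then have "J (J x) = J 0" by (simp only:)
  then show "x = 0" by (simp add: J_simps)
qed (simp add: J_simps)

lemma J_skew: "J x \<bullet> y = - (x \<bullet> J y)"
  using J_isometry[of x "J y"] unfolding J_J by simp

lemma inj_J: "inj J"
  by (simp add: linear_injective_0[OF linear_J])

abbreviation \<g> :: "'a set" where
  "\<g> \<equiv> commutator_ideal br"

abbreviation U :: "'a set" where
  "U \<equiv> transverse_space br J"

lemma subspace_ideal: "subspace \<g>"
  by (simp add: commutator_ideal_def bracket_span_def)

lemma br_in_ideal [simp]: "br x y \<in> \<g>"
  unfolding commutator_ideal_def bracket_span_def by (intro span_base) auto

text \<open>Invariance of the bracket and of the metric under \<open>J\<close> cancels every
  \<open>J\<close> in the pullback of \<open>d\<sigma>\<close>.\<close>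

lemma skt_iff_torsion:
  assumes "\<And>x y. br (J x) (J y) = br x y"
  shows "skt br J \<longleftrightarrow> integrable_structure br J \<and> (\<forall>a b c d. torsion_diff br a b c d = 0)"
proof -
  have "pullback J (ce_diff br (fundamental_form J)) [x, y, z] = - torsion br x y z" for x y z
    unfolding pullback_def torsion_def list.map ce_diff_fundamental_form assms J_isometry
    using br_skew[of x z] by simp
  then have eq: "ce_diff br (pullback J (ce_diff br (fundamental_form J))) [a, b, c, d] =
      torsion_diff br a b c d" for a b c d
    by (simp add: ce_diff_3form torsion_diff_def)
  have "(\<forall>Xs. length Xs = 4 \<longrightarrow> P Xs) \<longleftrightarrow> (\<forall>a b c d. P [a, b, c, d])" for P :: "'a list \<Rightarrow> bool"
    by (auto simp: numeral_eq_Suc length_Suc_conv)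
  then show ?thesis
    unfolding skt_def eq by (simp add: eq)
qed

section \<open>Decomposition of the Lie algebra into \<open>\<g>\<close>, its image under
  \<open>J\<close>, and \<open>U\<close>\<close>

lemma in_U_iff: "u \<in> U \<longleftrightarrow> (\<forall>v\<in>\<g>. v \<bullet> u = 0 \<and> J v \<bullet> u = 0)" (is "?l \<longleftrightarrow> ?r")
proof
  assume ?l
  then have orth: "(x + J y) \<bullet> u = 0" if "x \<in> \<g>" "y \<in> \<g>" for x y
    using that by (auto simp: transverse_space_def orthogonal_comp_def orthogonal_def)
  have "0 \<in> \<g>"
    using subspace_ideal by (rule subspace_0)
  then show ?r
    using orth[of _ 0] orth[of 0] J_simps(3) by auto
next
  assume ?r
  then show ?l
    by (auto simp: transverse_space_def orthogonal_comp_def orthogonal_def inner_add_left)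
qed

lemma subspace_U: "subspace U"
  by (simp add: transverse_space_def subspace_orthogonal_comp)

lemma J_in_U: "u \<in> U \<Longrightarrow> J u \<in> U"
  using J_skew[of _ u] by (simp add: in_U_iff)

lemma decompose:
  obtains v w u where "v \<in> \<g>" "w \<in> \<g>" "u \<in> U" "x = v + J w + u"
proof -
  define S where "S = {x + y | x y. x \<in> \<g> \<and> y \<in> J ` \<g>}"
  have "subspace S"
    unfolding S_def by (intro subspace_sums subspace_ideal linear_subspace_image linear_J)
  then have S: "span S = S"
    by simp
  obtain y z where "y \<in> span S" and z: "\<And>w. w \<in> span S \<Longrightarrow> orthogonal z w" and x: "x = y + z"
    by (rule orthogonal_subspace_decomp_exists[of S x]) blast
  then have "y \<in> S"
    by (simp add: S)
  then obtain v w where "v \<in> \<g>" "w \<in> \<g>" "y = v + J w"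
    by (auto simp: S_def)
  moreover have "z \<in> U"
    using z unfolding S transverse_space_def S_def[symmetric]
    by (simp add: orthogonal_comp_def orthogonal_commute)
  ultimately show thesis
    using that x by simp
qed

lemma dim_U:
  assumes "totally_real J \<g>"
  shows "dim U = DIM('a) - 2 * dim \<g>"
proof -
  let ?S = "{x + y | x y. x \<in> \<g> \<and> y \<in> J ` \<g>}"
  have S: "subspace ?S"
    by (intro subspace_sums subspace_ideal linear_subspace_image linear_J)
  have "dim (J ` \<g>) = dim \<g>"
    using inj_J inj_on_subset by (intro dim_image_eq linear_J) blast
  moreover have "dim ?S + dim (\<g> \<inter> J ` \<g>) = dim \<g> + dim (J ` \<g>)"
    by (intro dim_sums_Int subspace_ideal linear_subspace_image linear_J)
  ultimately have "dim ?S = 2 * dim \<g>"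
    using assms by (simp add: totally_real_def)
  moreover have "dim {y \<in> UNIV. \<forall>x \<in> ?S. orthogonal x y} + dim ?S = dim (UNIV :: 'a set)"
    by (intro dim_subspace_orthogonal_to_vectors S subspace_UNIV) simp
  moreover have "U = {y \<in> UNIV. \<forall>x \<in> ?S. orthogonal x y}"
    by (simp add: transverse_space_def orthogonal_comp_def)
  ultimately show ?thesis by simp
qed

text \<open>The functional \<open>\<beta>\<^sub>i\<close> of the overview, the eigenvalue of
  \<open>br x\<close> on \<open>X i\<close>. Defined through the inner product, it is linear in
  \<open>x\<close> before \<open>X i\<close> is known to be an eigenvector.\<close>

definition weight :: "(nat \<Rightarrow> 'a) \<Rightarrow> nat \<Rightarrow> 'a \<Rightarrow> real" where
  "weight X i x = br x (X i) \<bullet> X i"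

lemma weight_simps:
  "weight X i (x + y) = weight X i x + weight X i y"
  "weight X i (c *\<^sub>R x) = c * weight X i x"
  "weight X i (- x) = - weight X i x"
  "weight X i (x - y) = weight X i x - weight X i y"
  by (simp_all add: weight_def br_simps inner_simps)

lemma weight_sum: "weight X i (\<Sum>j\<in>I. c j *\<^sub>R v j) = (\<Sum>j\<in>I. c j * weight X i (v j))"
  by (simp add: weight_def linear_sum[OF linear_left] bilinear_lmul[OF bilinear_br] inner_sum_left)

end

section \<open>The diagonal bracket\<close>

text \<open>The common middle ground: SKT leads here, the listed brackets lead here, and SKT as well
  as the isomorphism are derived from it. The weights in \<open>br_eq\<close> are read off from
  \<open>br\<close> itself, so \<open>br_eq\<close> is a self-consistency condition.\<close>

locale diagonal_lie_algebra = hermitian_lie_algebra +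
  fixes X :: "nat \<Rightarrow> 'a" and lam :: "nat \<Rightarrow> real" and m :: nat
  assumes orthonormal:
      "\<And>i j. i \<in> {1..m} \<Longrightarrow> j \<in> {1..m} \<Longrightarrow> X i \<bullet> X j = (if i = j then 1 else 0)"
    and span_X: "span (X ` {1..m}) = \<g>"
    and lam_nonzero: "\<And>i. i \<in> {1..m} \<Longrightarrow> lam i \<noteq> 0"
    and br_X_X: "\<And>i j. i \<in> {1..m} \<Longrightarrow> j \<in> {1..m} \<Longrightarrow> br (X i) (X j) = 0"
    and br_JX_X: "\<And>i j. i \<in> {1..m} \<Longrightarrow> j \<in> {1..m} \<Longrightarrow>
      br (J (X i)) (X j) = (if i = j then lam i *\<^sub>R X i else 0)"
    and br_eq: "\<And>x y. br x y =
      (\<Sum>i=1..m. (1 / lam i * wedge (weight X i) (weight X i \<circ> J) x y) *\<^sub>R X i)"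
begin

abbreviation \<theta> :: "nat \<Rightarrow> 'a \<Rightarrow> 'a \<Rightarrow> real" where
  "\<theta> i \<equiv> wedge (weight X i) (weight X i \<circ> J)"

lemma X_in_ideal: "i \<in> {1..m} \<Longrightarrow> X i \<in> \<g>"
  using span_X span_base by (metis imageI)

lemma weight_X: "i \<in> {1..m} \<Longrightarrow> j \<in> {1..m} \<Longrightarrow> weight X i (X j) = 0"
  by (simp add: weight_def br_X_X)

lemma weight_JX: "i \<in> {1..m} \<Longrightarrow> j \<in> {1..m} \<Longrightarrow> weight X i (J (X j)) = (if i = j then lam i else 0)"
  by (simp add: weight_def br_JX_X orthonormal)

lemma \<theta>_J_J: "\<theta> i (J x) (J y) = \<theta> i x y"
  by (simp add: wedge_def weight_simps)

lemma br_J_J: "br (J x) (J y) = br x y"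
  by (simp add: br_eq[of "J x"] br_eq[of x] \<theta>_J_J)

lemma br_J_left: "br (J x) y = - br x (J y)"
proof -
  have "br x (J y) = - br (J x) y"
    using br_J_J[of x "J y"] by (simp add: br_simps)
  then show ?thesis by simp
qed

lemma integrable: "integrable_structure br J"
  unfolding integrable_structure_def by (simp add: br_J_left br_simps J_simps)

section \<open>Torsion of the diagonal bracket\<close>

lemma torsion_eq:
  "torsion br x y z = (\<Sum>i=1..m. 1 / lam i *
     (\<theta> i x y * (X i \<bullet> z) + \<theta> i y z * (X i \<bullet> x) + \<theta> i z x * (X i \<bullet> y)))"
  unfolding torsion_def br_eq[of x y] br_eq[of y z] br_eq[of z x]
  by (simp add: inner_sum_left sum.distrib[symmetric] distrib_left mult.assoc)

text \<open>Contracting \<open>\<theta> i\<close> with \<open>X j\<close> gives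
  \<open>- lam j\<close> times \<open>weight X j\<close> for \<open>i = j\<close> and zero
  otherwise, so one summand survives.\<close>

lemma torsion_X:
  assumes j: "j \<in> {1..m}"
  shows "torsion br (X j) z w =
    weight X j w * (X j \<bullet> z) - weight X j z * (X j \<bullet> w) + \<theta> j z w / lam j"
proof -
  have "torsion br (X j) z w = (\<Sum>i=1..m. if i = j then
      weight X j w * (X j \<bullet> z) - weight X j z * (X j \<bullet> w) + \<theta> j z w / lam j else 0)"
    unfolding torsion_eq
  proof (rule sum.cong[OF refl])
    fix i assume i: "i \<in> {1..m}"
    show "1 / lam i * (\<theta> i (X j) z * (X i \<bullet> w) + \<theta> i z w * (X i \<bullet> X j) + \<theta> i w (X j) * (X i \<bullet> z)) =
      (if i = j then weight X j w * (X j \<bullet> z) - weight X j z * (X j \<bullet> w) + \<theta> j z w / lam j else 0)"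
      using i j by (simp add: wedge_def weight_X weight_JX orthonormal lam_nonzero field_simps)
  qed
  then show ?thesis
    using j by simp
qed

lemma torsion_sum: "torsion br (\<Sum>i\<in>I. c i *\<^sub>R v i) z w = (\<Sum>i\<in>I. c i * torsion br (v i) z w)"
proof -
  have "linear (\<lambda>x. torsion br x z w)"
  proof (rule linearI)
    fix x y c
    show "torsion br (x + y) z w = torsion br x z w + torsion br y z w"
      by (simp add: torsion_def br_simps inner_simps)
    show "torsion br (c *\<^sub>R x) z w = c *\<^sub>R torsion br x z w"
      by (simp add: torsion_def br_simps distrib_left)
  qed
  from linear_sum[OF this, of "\<lambda>i. c i *\<^sub>R v i" I] linear_scale[OF this] show ?thesis
    by simp
qed

lemma torsion_br:
  "torsion br (br x y) z w = (\<Sum>i=1..m. 1 / lam i * \<theta> i x y *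
     (weight X i w * (X i \<bullet> z) - weight X i z * (X i \<bullet> w) + \<theta> i z w / lam i))"
  unfolding br_eq[of x y] torsion_sum by (intro sum.cong refl) (simp only: torsion_X)

text \<open>With \<open>\<xi>\<^sub>i = X\<^sub>i \<bullet> _\<close>, this is the sum of the forms \<open>\<theta>\<^sub>i \<and> (\<theta>\<^sub>i / \<lambda>\<^sub>i - weight\<^sub>i \<and> \<xi>\<^sub>i) / \<lambda>\<^sub>i\<close>, all of which
  vanish because \<open>\<theta>\<^sub>i\<close> is divisible by \<open>weight\<^sub>i\<close>.\<close>

lemma torsion_diff_zero: "torsion_diff br a b c d = 0"
  unfolding torsion_diff_def torsion_br sum.distrib[symmetric] sum_subtractf[symmetric]
  by (rule sum.neutral) (auto simp: wedge_def divide_inverse algebra_simps)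

lemma skt: "skt br J"
  using skt_iff_torsion integrable torsion_diff_zero br_J_J by blast

section \<open>Weights as coordinates and the isomorphism with the model\<close>

lemma in_ideal_eq_sum: "v \<in> \<g> \<Longrightarrow> v = (\<Sum>i=1..m. (X i \<bullet> v) *\<^sub>R X i)"
  unfolding span_X[symmetric] using orthonormal by (intro orthonormal_expansion) auto

lemma weight_ideal:
  assumes "i \<in> {1..m}" "v \<in> \<g>"
  shows "weight X i v = 0"
proof -
  have "weight X i v = (\<Sum>j=1..m. (X j \<bullet> v) * weight X i (X j))"
    by (subst in_ideal_eq_sum[OF assms(2)]) (rule weight_sum)
  then show ?thesis
    using assms by (simp add: weight_X)
qed

lemma weight_J_ideal:
  assumes "i \<in> {1..m}" "v \<in> \<g>"
  shows "weight X i (J v) = lam i * (X i \<bullet> v)"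
proof -
  have "weight X i (J v) = (\<Sum>j=1..m. (X j \<bullet> v) * weight X i (J (X j)))"
    by (subst in_ideal_eq_sum[OF assms(2)]) (simp only: J_simps weight_sum)
  also have "\<dots> = (\<Sum>j=1..m. if i = j then lam i * (X i \<bullet> v) else 0)"
    using assms by (intro sum.cong refl) (simp add: weight_JX)
  finally show ?thesis
    using assms by simp
qed

lemma inner_br:
  assumes "i \<in> {1..m}"
  shows "X i \<bullet> br x y = \<theta> i x y / lam i"
proof -
  have "X i \<bullet> br x y = (\<Sum>j=1..m. if i = j then \<theta> i x y / lam i else 0)"
    unfolding br_eq[of x y] inner_sum_right
    using assms by (intro sum.cong refl) (simp add: orthonormal)
  then show ?thesis
    using assms by simp
qed

lemma br_X:
  assumes "i \<in> {1..m}"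
  shows "br x (X i) = weight X i x *\<^sub>R X i"
proof -
  have "br x (X i) = (\<Sum>j=1..m. if i = j then weight X i x *\<^sub>R X i else 0)"
    unfolding br_eq[of x "X i"]
    using assms by (intro sum.cong refl) (simp add: wedge_def weight_X weight_JX lam_nonzero)
  then show ?thesis
    using assms by simp
qed

lemma br_JX:
  assumes "i \<in> {1..m}"
  shows "br x (J (X i)) = - weight X i (J x) *\<^sub>R X i"
  using br_J_left[of x "X i"] br_X[OF assms, of "J x"] by simp

text \<open>\<open>weight X i\<close> vanishes on brackets, and
  \<open>weight X i (J (br x y)) = \<theta> i x y\<close> is the bracket of \<open>aff\<close> in
  the coordinates \<open>weight X i\<close> and \<open>weight X i \<circ> J\<close>. Orthonormal
  coordinates on \<open>U\<close> give the Abelian summand, as brackets are orthogonal to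
  \<open>U\<close>.\<close>

lemma isomorphic_m_aff:
  assumes "totally_real J \<g>" "dim \<g> = m"
  shows "lie_isomorphic UNIV br (m_aff_sum_abelian m (DIM('a) - 2 * m)) m_aff_sum_abelian_bracket"
proof -
  define d where "d = DIM('a) - 2 * m"
  have "dim U = d"
    using dim_U assms by (simp add: d_def)
  then obtain e :: "nat \<Rightarrow> 'a" where
    e: "\<And>i j. i < d \<Longrightarrow> j < d \<Longrightarrow> e i \<bullet> e j = (if i = j then 1 else 0)" "span (e ` {..<d}) = U"
    using orthonormal_basis_indexed[OF subspace_U] by metis
  have eU: "e k \<in> U" if "k < d" for k
    using e(2) that span_base by (metis imageI lessThan_iff)
  have e_ideal: "e k \<bullet> v = 0" "e k \<bullet> J v = 0" if "k < d" "v \<in> \<g>" for k v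
    using eU[OF that(1)] that(2) by (auto simp: in_U_iff inner_commute)
  \<comment> \<open>The copies are numbered from \<open>0\<close>, the \<open>X i\<close> from
    \<open>1\<close>; hence \<open>Suc i\<close>.\<close>
  define \<phi> where "\<phi> x = (finite_seq m (\<lambda>i. (weight X (Suc i) x, weight X (Suc i) (J x))),
      finite_seq d (\<lambda>k. e k \<bullet> x))" for x
  have lin: "linear \<phi>"
    by (rule linearI) (auto simp: \<phi>_def prod_eq_iff lookup_add lookup_scaleR weight_simps J_simps
        inner_simps intro!: poly_mapping_eqI)
  have "inj \<phi>"
    unfolding linear_injective_0[OF lin]
  proof (intro allI impI)
    fix x assume "\<phi> x = 0"
    then have 0: "finite_seq m (\<lambda>i. (weight X (Suc i) x, weight X (Suc i) (J x))) = 0"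
        "finite_seq d (\<lambda>k. e k \<bullet> x) = 0"
      by (auto simp: \<phi>_def zero_prod_def)
    have wx: "weight X i x = 0 \<and> weight X i (J x) = 0" if i: "i \<in> {1..m}" for i
    proof -
      obtain k where "i = Suc k" "k < m"
        using i by (cases i) auto
      then show ?thesis
        using arg_cong[OF 0(1), of "\<lambda>f. Poly_Mapping.lookup f k"] by (simp add: zero_prod_def)
    qed
    have ex: "e k \<bullet> x = 0" if "k < d" for k
      using arg_cong[OF 0(2), of "\<lambda>f. Poly_Mapping.lookup f k"] that by simp
    obtain v w u where x: "v \<in> \<g>" "w \<in> \<g>" "u \<in> U" "x = v + J w + u"
      by (rule decompose)
    have "u = (\<Sum>k<d. (e k \<bullet> u) *\<^sub>R e k)"
      using e x(3) by (intro orthonormal_expansion) auto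
    moreover have "e k \<bullet> u = 0" if "k < d" for k
      using ex[OF that] e_ideal[OF that] x by (simp add: inner_simps)
    ultimately have u: "u = 0" by simp
    \<comment> \<open>For \<open>x = v + J w\<close> the two coordinates are
      \<open>lam i * (X i \<bullet> w)\<close> and \<open>lam i * (X i \<bullet> v)\<close>.\<close>
    have 0: "X i \<bullet> v = 0" "X i \<bullet> w = 0" if i: "i \<in> {1..m}" for i
      using wx[OF i] lam_nonzero[OF i]
      by (simp_all add: x u weight_simps J_simps weight_ideal[OF i] weight_J_ideal[OF i])
    have "v = 0"
      by (subst in_ideal_eq_sum[OF x(1)]) (simp add: 0)
    moreover have "w = 0"
      by (subst in_ideal_eq_sum[OF x(2)]) (simp add: 0)
    ultimately show "x = 0"
      using x u J_simps by simp
  qed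
  moreover have "\<phi> x \<in> m_aff_sum_abelian m d" for x
    by (auto simp: \<phi>_def m_aff_sum_abelian_def copies_def in_keys_iff split: if_splits)
  moreover have "f \<in> range \<phi>" if f: "f \<in> m_aff_sum_abelian m d" for f
  proof -
    \<comment> \<open>Preimage of \<open>f\<close>: the Abelian coordinates dictate
      \<open>u\<close>; then \<open>w\<close> and \<open>v\<close> supply what the weights of
      \<open>u\<close> and \<open>J u\<close> leave missing.\<close>
    let ?F = "\<lambda>i. Poly_Mapping.lookup (fst f) (i - 1)" and ?h = "Poly_Mapping.lookup (snd f)"
    define u where "u = (\<Sum>k<d. ?h k *\<^sub>R e k)"
    define w where "w = (\<Sum>i=1..m. ((fst (?F i) - weight X i u) / lam i) *\<^sub>R X i)"
    define v where "v = (\<Sum>i=1..m. ((snd (?F i) - weight X i (J u)) / lam i) *\<^sub>R X i)"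
    have vw: "v \<in> \<g>" "w \<in> \<g>"
      unfolding v_def w_def
      using X_in_ideal by (auto intro!: subspace_sum subspace_scale subspace_ideal)
    have eu: "e k \<bullet> u = ?h k" if "k < d" for k
      unfolding u_def using e(1) that by (intro inner_orthonormal_sum) auto
    have inner: "X i \<bullet> (\<Sum>j=1..m. c j *\<^sub>R X j) = c i" if "i \<in> {1..m}" for c i
      using that orthonormal by (intro inner_orthonormal_sum) auto
    have "\<phi> (v + J w + u) = f"
    proof (rule prod_eqI; rule poly_mapping_eqI)
      fix i
      show "Poly_Mapping.lookup (snd (\<phi> (v + J w + u))) i = ?h i"
        using e_ideal vw eu f
        by (auto simp: \<phi>_def inner_simps m_aff_sum_abelian_def copies_def in_keys_iff)
      show "Poly_Mapping.lookup (fst (\<phi> (v + J w + u))) i = Poly_Mapping.lookup (fst f) i"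
      proof (cases "i < m")
        case True
        then have i: "Suc i \<in> {1..m}" by simp
        show ?thesis
          using True lam_nonzero[OF i] inner[OF i]
          by (simp add: \<phi>_def weight_simps J_simps weight_ideal[OF i] weight_J_ideal[OF i] vw)
            (simp add: v_def w_def)
      next
        case False
        then show ?thesis
          using f by (auto simp: \<phi>_def m_aff_sum_abelian_def copies_def in_keys_iff)
      qed
    qed
    then show ?thesis by blast
  qed
  moreover have "\<phi> (br x y) = m_aff_sum_abelian_bracket (\<phi> x) (\<phi> y)" for x y
  proof (rule prod_eqI; rule poly_mapping_eqI)
    fix i
    show "Poly_Mapping.lookup (snd (\<phi> (br x y))) i
        = Poly_Mapping.lookup (snd (m_aff_sum_abelian_bracket (\<phi> x) (\<phi> y))) i"
      using e_ideal by (simp add: \<phi>_def m_aff_sum_abelian_bracket_def)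
    have "aff_bracket 0 0 = 0"
      by (simp add: aff_bracket_def zero_prod_def)
    then show "Poly_Mapping.lookup (fst (\<phi> (br x y))) i
        = Poly_Mapping.lookup (fst (m_aff_sum_abelian_bracket (\<phi> x) (\<phi> y))) i"
      using lam_nonzero[of "Suc i"]
      by (simp add: \<phi>_def m_aff_sum_abelian_bracket_def lookup_copies_bracket weight_ideal
          weight_J_ideal inner_br) (simp add: aff_bracket_def wedge_def)
  qed
  ultimately show ?thesis
    unfolding lie_isomorphic_def d_def[symmetric] using lin
    by (intro exI[of _ \<phi>]) (auto simp: bij_betw_def)
qed

end

section \<open>From SKT to the diagonal bracket\<close>

context hermitian_lie_algebra
begin

text \<open>Integrability reads \<open>?v = J ?w\<close> with both \<open>?v\<close> and
  \<open>?w\<close> in \<open>\<g>\<close>; total reality forces both to vanish.\<close>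

lemma integrable_totally_real:
  assumes "integrable_structure br J" "totally_real J \<g>"
  shows "br (J x) (J y) = br x y" and "br (J x) y = - br x (J y)"
proof -
  let ?v = "br (J x) (J y) - br x y" and ?w = "br (J x) y + br x (J y)"
  have "?v = J ?w"
    using assms(1) by (simp add: integrable_structure_def J_simps algebra_simps)
  moreover have "?v \<in> \<g>" "?w \<in> \<g>"
    by (simp_all add: subspace_diff subspace_add subspace_ideal)
  ultimately have "J ?w \<in> \<g> \<inter> J ` \<g>"
    by (metis Int_iff imageI)
  then have "J ?w = 0"
    using assms(2) by (simp only: totally_real_def singleton_iff)
  then have "?v = 0" "?w = 0"
    using \<open>?v = J ?w\<close> by (simp_all only: J_eq_0_iff)
  then show "br (J x) (J y) = br x y" "br (J x) y = - br x (J y)"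
    by (simp_all add: eq_neg_iff_add_eq_0)
qed

abbreviation prod_J :: "'a \<Rightarrow> 'a \<Rightarrow> 'a" (infixl "\<star>" 75) where
  "x \<star> y \<equiv> br (J x) y"

lemma bilinear_prod_J: "bilinear (\<lambda>x y. x \<star> y)"
  by (auto simp: bilinear_def br_simps J_simps intro!: linearI)

context
  assumes skt: "skt br J" and two_step: "two_step_solvable br"
    and totally_real: "totally_real J \<g>"
    and bracket_span: "bracket_span br \<g> (J ` \<g>) = \<g>"
begin

lemma J_br: "br (J x) (J y) = br x y" "br x (J y) = - (x \<star> y)"
  using integrable_totally_real[OF _ totally_real] skt by (simp_all add: skt_def)

lemma ideal_abelian: "x \<in> \<g> \<Longrightarrow> y \<in> \<g> \<Longrightarrow> br x y = 0"
  using two_step by (simp add: two_step_solvable_def)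

lemma prod_J_commute: "x \<star> y = y \<star> x"
  using br_skew[of "J x" y] J_br(2)[of y x] by simp

text \<open>In the Jacobi identity the term \<open>br (br y (J x)) z\<close> drops out because
  \<open>\<g>\<close> is Abelian. With \<open>J z\<close> as the acting element this also yields
  associativity.\<close>

lemma prod_J_br:
  assumes "x \<in> \<g>" "z \<in> \<g>"
  shows "br y (x \<star> z) = x \<star> br y z"
proof -
  have "br (br y (J x)) z = 0"
    using assms by (simp add: ideal_abelian)
  then show ?thesis
    using br_derivation[of y "J x" z] by simp
qed

lemma prod_J_assoc:
  assumes "x \<in> \<g>" "y \<in> \<g>" "z \<in> \<g>"
  shows "x \<star> y \<star> z = x \<star> (y \<star> z)"
proof -
  have "x \<star> y \<star> z = z \<star> (x \<star> y)"
    by (rule prod_J_commute)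
  also have "\<dots> = x \<star> (z \<star> y)"
    using assms by (intro prod_J_br) auto
  finally show ?thesis
    by (simp only: prod_J_commute[of z y])
qed

text \<open>The SKT equation on \<open>(x, y, J z, J w)\<close>.\<close>

lemma inner_prod_J_swap:
  assumes "x \<in> \<g>" "y \<in> \<g>" "z \<in> \<g>" "w \<in> \<g>"
  shows "x \<star> z \<bullet> y \<star> w = y \<star> z \<bullet> x \<star> w"
proof -
  have torsion: "torsion br u v (J t) = v \<bullet> u \<star> t - u \<bullet> v \<star> t"
    if "u \<in> \<g>" "v \<in> \<g>" "t \<in> \<g>" for u v t
    using that J_br(2)[of v t] ideal_abelian[of u v] prod_J_commute[of t u]
    by (simp add: torsion_def inner_commute)
  have "torsion_diff br x y (J z) (J w) = 0"
    using skt_iff_torsion[OF J_br(1)] skt by blast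
  moreover have "br x y = 0" "br (J z) (J w) = 0"
    using assms by (simp_all add: J_br(1) ideal_abelian)
  ultimately have "torsion br (x \<star> z) y (J w) - torsion br (x \<star> w) y (J z)
      - torsion br (y \<star> z) x (J w) + torsion br (y \<star> w) x (J z) = 0"
    by (simp add: torsion_diff_def J_br(2)) (simp add: torsion_def br_simps)
  \<comment> \<open>This symmetry in \<open>z\<close> and \<open>w\<close> cancels the triple
    products; twice the claimed difference remains.\<close>
  moreover have "x \<star> z \<star> w = x \<star> w \<star> z" "y \<star> z \<star> w = y \<star> w \<star> z"
    using assms by (simp_all only: prod_J_assoc prod_J_commute[of z w])
  ultimately show ?thesis
    using assms by (simp add: torsion inner_commute)
qed

lemma prod_J_spans: "span {x \<star> y | x y. x \<in> \<g> \<and> y \<in> \<g>} = \<g>"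
proof
  show "span {x \<star> y | x y. x \<in> \<g> \<and> y \<in> \<g>} \<subseteq> \<g>"
    by (rule span_minimal) (auto simp: subspace_ideal)
  have "br x y \<in> span {x \<star> y | x y. x \<in> \<g> \<and> y \<in> \<g>}" if x: "x \<in> \<g>" and y: "y \<in> J ` \<g>" for x y
  proof -
    obtain z where z: "z \<in> \<g>" "y = J z"
      using y by auto
    then have "- (x \<star> z) \<in> span {x \<star> y | x y. x \<in> \<g> \<and> y \<in> \<g>}"
      using x by (intro span_neg span_base) blast
    then show ?thesis
      using z by (simp only: J_br(2))
  qed
  then show "\<g> \<subseteq> span {x \<star> y | x y. x \<in> \<g> \<and> y \<in> \<g>}"
    by (subst bracket_span[symmetric], unfold bracket_span_def)
      (rule span_minimal, auto)
qed

text \<open>Products span \<open>\<g>\<close>, so \<open>x = a \<star> b\<close> and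
  \<open>y = c \<star> d\<close> suffice. There \<open>swap\<close> exchanges inner factors, and two
  swaps with reassociation in between carry \<open>z\<close> from \<open>a\<close> to
  \<open>c\<close>.\<close>

lemma prod_J_symmetric:
  assumes "x \<in> \<g>" "y \<in> \<g>" "z \<in> \<g>"
  shows "z \<star> x \<bullet> y = x \<bullet> z \<star> y"
proof -
  let ?P = "{x \<star> y | x y. x \<in> \<g> \<and> y \<in> \<g>}"
  have swap: "a \<star> b \<bullet> c \<star> d = a \<star> c \<bullet> b \<star> d"
    if "a \<in> \<g>" "b \<in> \<g>" "c \<in> \<g>" "d \<in> \<g>" for a b c d
    using inner_prod_J_swap[of b c a d] that by (simp only: prod_J_commute[of a])
  have "z \<star> u \<bullet> v = u \<bullet> z \<star> v" if "u \<in> ?P" "v \<in> ?P" for u v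
  proof -
    obtain a b c d where u: "u = a \<star> b" "a \<in> \<g>" "b \<in> \<g>" and v: "v = c \<star> d" "c \<in> \<g>" "d \<in> \<g>"
      using \<open>u \<in> ?P\<close> \<open>v \<in> ?P\<close> by blast
    have "z \<star> u \<bullet> v = (z \<star> a) \<star> b \<bullet> c \<star> d"
      using u v assms by (simp add: prod_J_assoc)
    also have "\<dots> = (z \<star> a) \<star> c \<bullet> b \<star> d"
      using u v by (intro swap) auto
    also have "(z \<star> a) \<star> c = (z \<star> c) \<star> a"
      using u v assms by (simp add: prod_J_assoc prod_J_commute[of a c])
    also have "(z \<star> c) \<star> a \<bullet> b \<star> d = a \<star> (z \<star> c) \<bullet> b \<star> d"
      by (simp only: prod_J_commute[of a "z \<star> c"])
    also have "\<dots> = a \<star> b \<bullet> (z \<star> c) \<star> d"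
      using u v by (intro swap) auto
    also have "\<dots> = u \<bullet> z \<star> v"
      using u v assms by (simp add: prod_J_assoc)
    finally show ?thesis .
  qed
  moreover have "bilinear (\<lambda>u v. z \<star> u \<bullet> v)" "bilinear (\<lambda>u v. u \<bullet> z \<star> v)"
    by (auto simp: bilinear_def br_simps inner_simps intro!: linearI)
  ultimately show ?thesis
    using assms prod_J_spans bilinear_eq[of "\<lambda>u v. z \<star> u \<bullet> v" "\<lambda>u v. u \<bullet> z \<star> v" \<g> ?P \<g> ?P x y]
    by simp
qed

lemma symmetric_algebra_prod_J: "symmetric_algebra \<g> (\<lambda>x y. x \<star> y)"
proof
  show "x \<star> y \<bullet> z = y \<bullet> x \<star> z" if "x \<in> \<g>" "y \<in> \<g>" "z \<in> \<g>" for x y z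
    using that by (intro prod_J_symmetric)
qed (simp_all add: subspace_ideal bilinear_prod_J prod_J_assoc, rule prod_J_commute)

text \<open>The diagonalized product on \<open>\<g>\<close> determines the bracket everywhere, since
  all brackets lie in \<open>\<g>\<close> and \<open>X i \<star> _\<close> extracts their
  \<open>i\<close>-th coordinate.\<close>

lemma skt_imp_diagonal:
  assumes "dim \<g> = m"
  shows "\<exists>X lam. diagonal_lie_algebra br J X lam m"
proof -
  obtain X lam where
    orth: "\<And>i j. i \<in> {1..m} \<Longrightarrow> j \<in> {1..m} \<Longrightarrow> X i \<bullet> X j = (if i = j then 1 else 0)"
    and span: "span (X ` {1..m}) = \<g>"
    and prod: "\<And>i j. i \<in> {1..m} \<Longrightarrow> j \<in> {1..m} \<Longrightarrow>
      X i \<star> X j = (if i = j then lam i *\<^sub>R X i else 0)"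
    using symmetric_algebra_diagonalizable[OF symmetric_algebra_prod_J assms] by blast
  have X: "X i \<in> \<g>" if "i \<in> {1..m}" for i
    using span_base[of "X i" "X ` {1..m}"] that span by auto
  have expand: "v = (\<Sum>i=1..m. (X i \<bullet> v) *\<^sub>R X i)" if "v \<in> \<g>" for v
    using orth that span by (intro orthonormal_expansion) auto
  have X_prod: "X i \<star> v = (lam i * (X i \<bullet> v)) *\<^sub>R X i" if i: "i \<in> {1..m}" and v: "v \<in> \<g>" for i v
  proof (rule linear_eq_on_span[where f = "\<lambda>v. X i \<star> v" and B = "X ` {1..m}"])
    show "linear (\<lambda>v. X i \<star> v)"
      using bilinear_br by (simp add: bilinear_def)
    show "linear (\<lambda>v. (lam i * (X i \<bullet> v)) *\<^sub>R X i)"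
      by (intro linearI) (simp_all add: inner_simps algebra_simps)
    show "v \<in> span (X ` {1..m})"
      using v span by simp
    fix y assume "y \<in> X ` {1..m}"
    then show "X i \<star> y = (lam i * (X i \<bullet> y)) *\<^sub>R X i"
      using i prod orth by auto
  qed
  \<comment> \<open>If \<open>lam i = 0\<close>, then \<open>X i\<close> annihilates
    \<open>\<g>\<close>, so by symmetry it is orthogonal to all products and hence to
    itself.\<close>
  have lam: "lam i \<noteq> 0" if i: "i \<in> {1..m}" for i
  proof
    assume "lam i = 0"
    then have 0: "X i \<star> v = 0" if "v \<in> \<g>" for v
      using X_prod[OF i that] by simp
    have "orthogonal (X i) (u \<star> v)" if "u \<in> \<g>" "v \<in> \<g>" for u v
    proof -
      have "u \<star> v \<bullet> X i = v \<bullet> u \<star> X i"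
        using prod_J_symmetric[of v "X i" u] that X[OF i] by simp
      also have "u \<star> X i = 0"
        using 0[OF that(1)] by (simp only: prod_J_commute[of u])
      finally show ?thesis
        by (simp add: orthogonal_def inner_commute)
    qed
    then have "orthogonal (X i) (X i)"
      using X[OF i] prod_J_spans
      by (intro orthogonal_to_span[of "X i" "{x \<star> y | x y. x \<in> \<g> \<and> y \<in> \<g>}"]) auto
    then show False
      using orth[OF i i] by (simp add: orthogonal_def)
  qed
  \<comment> \<open>Apply \<open>br x\<close> to
    \<open>X i \<star> X i = lam i *\<^sub>R X i\<close>; multiplication by \<open>X i\<close> maps
    into the line of \<open>X i\<close>.\<close>
  have br_X: "br x (X i) = weight X i x *\<^sub>R X i" if i: "i \<in> {1..m}" for x i
  proof -
    have "lam i *\<^sub>R br x (X i) = X i \<star> br x (X i)"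
      using prod_J_br[OF X[OF i] X[OF i], of x] prod[OF i i] by (simp add: br_simps)
    also have "\<dots> = lam i *\<^sub>R (weight X i x *\<^sub>R X i)"
      using X_prod[OF i] by (simp add: weight_def inner_commute)
    finally show ?thesis
      unfolding scaleR_cancel_left using lam[OF i] by simp
  qed
  \<comment> \<open>Two evaluations of \<open>X i \<star> br x y\<close> are compared: as a multiple
    of \<open>X i\<close>, and by the Leibniz rule for \<open>br (J (X i))\<close>.\<close>
  have inner_br: "X i \<bullet> br x y = 1 / lam i * wedge (weight X i) (weight X i \<circ> J) x y"
    if i: "i \<in> {1..m}" for x y i
  proof -
    have "X i \<star> x = weight X i (J x) *\<^sub>R X i" for x
      using br_X[OF i, of "J x"] by (simp only: prod_J_commute[of "X i"])
    then have "X i \<star> br x y = weight X i (J x) *\<^sub>R br (X i) y + weight X i (J y) *\<^sub>R br x (X i)"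
      using br_derivation[of "J (X i)" x y] by (simp add: br_simps)
    also have "br (X i) y = - weight X i y *\<^sub>R X i"
      using br_skew[of "X i" y] br_X[OF i] by simp
    also have "br x (X i) = weight X i x *\<^sub>R X i"
      by (rule br_X[OF i])
    finally have "lam i * (X i \<bullet> br x y) = wedge (weight X i) (weight X i \<circ> J) x y"
      using X_prod[OF i, of "br x y"] orth[OF i i]
      by (auto dest!: arg_cong[where f = "\<lambda>v. X i \<bullet> v"] simp: wedge_def inner_simps algebra_simps)
    then show ?thesis
      using lam[OF i] by (simp add: field_simps)
  qed
  have "diagonal_lie_algebra br J X lam m"
  proof
    show "br x y = (\<Sum>i=1..m. (1 / lam i * wedge (weight X i) (weight X i \<circ> J) x y) *\<^sub>R X i)" for x y
      by (subst expand[OF br_in_ideal]) (simp only: inner_br cong: sum.cong)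
  qed (use orth span lam prod X ideal_abelian in auto)
  then show ?thesis by blast
qed

end

section \<open>From the listed brackets to the diagonal bracket\<close>

lemma span_ideal_U:
  assumes "span (X ` I) = \<g>"
  shows "span (X ` I \<union> (\<lambda>i. J (X i)) ` I \<union> U) = UNIV"
proof -
  let ?B = "X ` I \<union> (\<lambda>i. J (X i)) ` I \<union> U"
  have "x \<in> span ?B" for x
  proof -
    obtain v w u where x: "v \<in> \<g>" "w \<in> \<g>" "u \<in> U" "x = v + J w + u"
      by (rule decompose)
    have "J w \<in> span ((\<lambda>i. J (X i)) ` I)"
      using x(2) linear_span_image[OF linear_J, of "X ` I"] assms by (auto simp: image_image)
    then show ?thesis
      unfolding x(4) using x assms span_mono[of _ ?B]
      by (intro span_add) (blast intro: span_base)+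
  qed
  then show ?thesis by blast
qed

text \<open>Both sides of the bracket formula are bilinear, so they are compared on the spanning set
  \<open>?B\<close>; on \<open>U\<close> the weights are the given \<open>mu i\<close>.\<close>

lemma brackets_imp_diagonal:
  assumes orth: "\<And>i j. i \<in> {1..m} \<Longrightarrow> j \<in> {1..m} \<Longrightarrow> X i \<bullet> X j = (if i = j then 1 else 0)"
    and span: "span (X ` {1..m}) = \<g>"
    and lam: "\<And>i. i \<in> {1..m} \<Longrightarrow> lam i \<noteq> 0"
    and JX_X: "\<And>i. i \<in> {1..m} \<Longrightarrow> br (J (X i)) (X i) = lam i *\<^sub>R X i"
    and U_X: "\<And>i Y. i \<in> {1..m} \<Longrightarrow> Y \<in> U \<Longrightarrow> br Y (X i) = mu i Y *\<^sub>R X i"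
    and U_JX: "\<And>i Y. i \<in> {1..m} \<Longrightarrow> Y \<in> U \<Longrightarrow> br Y (J (X i)) = - mu i (J Y) *\<^sub>R X i"
    and U_U: "\<And>Y Z. Y \<in> U \<Longrightarrow> Z \<in> U \<Longrightarrow>
      br Y Z = (\<Sum>i=1..m. (1 / lam i * wedge (mu i) (mu i \<circ> J) Y Z) *\<^sub>R X i)"
    and JX_X': "\<And>i j. i \<in> {1..m} \<Longrightarrow> j \<in> {1..m} \<Longrightarrow> i \<noteq> j \<Longrightarrow> br (J (X i)) (X j) = 0"
    and X_X: "\<And>i j. i \<in> {1..m} \<Longrightarrow> j \<in> {1..m} \<Longrightarrow> br (X i) (X j) = 0"
    and JX_JX: "\<And>i j. i \<in> {1..m} \<Longrightarrow> j \<in> {1..m} \<Longrightarrow> br (J (X i)) (J (X j)) = 0"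
  shows "diagonal_lie_algebra br J X lam m"
proof
  let ?B = "X ` {1..m} \<union> (\<lambda>i. J (X i)) ` {1..m} \<union> U"
  let ?S = "\<lambda>x y. \<Sum>i=1..m. (1 / lam i * wedge (weight X i) (weight X i \<circ> J) x y) *\<^sub>R X i"
  have w: "weight X i (X j) = 0" "weight X i (J (X j)) = (if i = j then lam i else 0)"
    if "i \<in> {1..m}" "j \<in> {1..m}" for i j
    using that orth JX_X JX_X' X_X by (auto simp: weight_def)
  have wU: "weight X i Y = mu i Y" "weight X i (J Y) = mu i (J Y)"
    if "i \<in> {1..m}" "Y \<in> U" for i Y
    using that orth U_X J_in_U by (simp_all add: weight_def)
  \<comment> \<open>Collapses the sum when at most the \<open>j\<close>-th form is nonzero at
    \<open>(x, y)\<close>; \<open>c = 0\<close> covers vanishing brackets.\<close>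
  have single: "?S x y = c *\<^sub>R X j"
    if "j \<in> {1..m}" and "\<And>i. i \<in> {1..m} \<Longrightarrow>
      wedge (weight X i) (weight X i \<circ> J) x y = (if i = j then lam j * c else 0)" for x y c j
  proof -
    have "?S x y = (\<Sum>i=1..m. if i = j then c *\<^sub>R X j else 0)"
      using that lam by (intro sum.cong refl) auto
    then show ?thesis
      using that by simp
  qed
  have skew: "?S x y = - ?S y x" for x y
    by (simp add: wedge_def sum_negf[symmetric] algebra_simps)
  have eq: "br x y = ?S x y" if "x \<in> ?B" "y \<in> ?B" for x y
  proof -
    have 1: "br (X i) (X j) = ?S (X i) (X j)" if "i \<in> {1..m}" "j \<in> {1..m}" for i j
      using that X_X by (subst single[of i _ _ 0]) (auto simp: wedge_def w)
    have 2: "br (J (X i)) (X j) = ?S (J (X i)) (X j)" if "i \<in> {1..m}" "j \<in> {1..m}" for i j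
      using that JX_X JX_X'
      by (subst single[of i _ _ "if i = j then lam i else 0"]) (auto simp: wedge_def w)
    have 3: "br (J (X i)) (J (X j)) = ?S (J (X i)) (J (X j))" if "i \<in> {1..m}" "j \<in> {1..m}" for i j
      using that JX_JX by (subst single[of i _ _ 0]) (auto simp: wedge_def w weight_simps)
    have 4: "br Y (X i) = ?S Y (X i)" if "Y \<in> U" "i \<in> {1..m}" for Y i
      using that U_X by (subst single[of i _ _ "mu i Y"]) (auto simp: wedge_def w wU)
    have 5: "br Y (J (X i)) = ?S Y (J (X i))" if "Y \<in> U" "i \<in> {1..m}" for Y i
      using that U_JX
      by (subst single[of i _ _ "- mu i (J Y)"]) (auto simp: wedge_def w wU weight_simps)
    have 6: "br Y Z = ?S Y Z" if "Y \<in> U" "Z \<in> U" for Y Z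
      using that U_U by (simp add: wedge_def wU)
    \<comment> \<open>\<open>?B\<close> has three blocks, hence nine kinds of pairs; the three mixed
      kinds in reversed order follow by skew-symmetry.\<close>
    have flip: "br x y = ?S x y" if "br y x = ?S y x" for x y
      using br_skew[of x y] skew[of x y] that by simp
    show ?thesis
      using that 1 2 3 4 5 6 flip[OF 2] flip[OF 4] flip[OF 5] by (elim UnE imageE) simp_all
  qed
  have "bilinear ?S"
    by (auto simp: bilinear_def wedge_def weight_simps J_simps algebra_simps sum.distrib sum_subtractf
        scaleR_sum_right add_divide_distrib intro!: linearI)
  then show "br x y = ?S x y" for x y
    using bilinear_eq[OF bilinear_br, of ?S UNIV ?B UNIV ?B x y] eq span_ideal_U[OF span] by simp
qed (use assms in auto)

end

theorem corollary5p6: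
  fixes br :: "'a::euclidean_space \<Rightarrow> 'a \<Rightarrow> 'a" and J :: "'a \<Rightarrow> 'a" and n m :: nat
  assumes "almost_hermitian_lie_algebra br J"
    and "DIM('a) = 2 * n"
    and "two_step_solvable br"
    and "totally_real J (commutator_ideal br)"
    and "dim (commutator_ideal br) = m"
    and "bracket_span br (commutator_ideal br) (J ` commutator_ideal br) = commutator_ideal br"
  shows "(skt br J \<longleftrightarrow>
      (\<exists>(X :: nat \<Rightarrow> 'a) (lam :: nat \<Rightarrow> real) (mu :: nat \<Rightarrow> 'a \<Rightarrow> real).
         (\<forall>i\<in>{1..m}. \<forall>j\<in>{1..m}. X i \<bullet> X j = (if i = j then 1 else 0)) \<and>
         span (X ` {1..m}) = commutator_ideal br \<and>
         (\<forall>i\<in>{1..m}. lam i \<noteq> 0) \<and>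
         (\<forall>i\<in>{1..m}. mu i \<in> dual_on (transverse_space br J)) \<and>
         (\<forall>i\<in>{1..m}. br (J (X i)) (X i) = lam i *\<^sub>R X i) \<and>
         (\<forall>i\<in>{1..m}. \<forall>Y\<in>transverse_space br J. br Y (X i) = mu i Y *\<^sub>R X i) \<and>
         (\<forall>i\<in>{1..m}. \<forall>Y\<in>transverse_space br J. br Y (J (X i)) = - mu i (J Y) *\<^sub>R X i) \<and>
         (\<forall>Y\<in>transverse_space br J. \<forall>Z\<in>transverse_space br J.
            br Y Z = (\<Sum>i=1..m. (1 / lam i * wedge (mu i) (mu i \<circ> J) Y Z) *\<^sub>R X i)) \<and>
         (\<forall>i\<in>{1..m}. \<forall>j\<in>{1..m}. i \<noteq> j \<longrightarrow> br (J (X i)) (X j) = 0) \<and>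
         (\<forall>i\<in>{1..m}. \<forall>j\<in>{1..m}. br (X i) (X j) = 0) \<and>
         (\<forall>i\<in>{1..m}. \<forall>j\<in>{1..m}. br (J (X i)) (J (X j)) = 0)))
    \<and> (skt br J \<longrightarrow>
         lie_isomorphic UNIV br (m_aff_sum_abelian m (2 * n - 2 * m)) m_aff_sum_abelian_bracket)"
    (is "(_ \<longleftrightarrow> ?brackets) \<and> _")
proof -
  interpret hermitian_lie_algebra br J
    by unfold_locales (rule assms(1))
  have diagonal: "\<exists>X lam. diagonal_lie_algebra br J X lam m" if "skt br J"
    using skt_imp_diagonal that assms by blast
  have "?brackets" if skt: "skt br J"
  proof -
    obtain X lam where "diagonal_lie_algebra br J X lam m"
      using diagonal[OF skt] by blast
    then interpret diagonal_lie_algebra br J X lam m .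
    \<comment> \<open>The full functional \<open>weight X i\<close> serves as \<open>mu i\<close>,
      as only its values on \<open>U\<close> matter.\<close>
    show ?thesis
      using orthonormal span_X lam_nonzero br_X_X br_JX_X br_X br_JX br_eq
      by (intro exI[of _ X] exI[of _ lam] exI[of _ "weight X"])
        (auto simp: br_J_J dual_on_def weight_simps)
  qed
  moreover have "skt br J" if ?brackets
  proof -
    have "\<exists>X lam. diagonal_lie_algebra br J X lam m"
      using that by (elim exE conjE) (intro exI, rule brackets_imp_diagonal, auto)
    then show ?thesis
      using diagonal_lie_algebra.skt by blast
  qed
  moreover have "lie_isomorphic UNIV br (m_aff_sum_abelian m (2 * n - 2 * m)) m_aff_sum_abelian_bracket"
    if "skt br J"
    using diagonal[OF that] diagonal_lie_algebra.isomorphic_m_aff assms(2,4,5) by metis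
  ultimately show ?thesis by blast
qed

end
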